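(* Let $\{S_i\}_{i\in\mathcal I}$ be an IFS with associated self-similar measure $\mu_{\mathbf p}$. If $\eta$ is any admissible path in the transition graph realized by net intervals $(\Delta_i)_{i=0}^m$, then $$\boldsymbol\mu(\Delta_0)\,T(\eta)=\boldsymbol\mu(\Delta_m).$$
   Context: IFS. An iterated function system of similarities (IFS) is a finite set of (distinct) maps $S_i(x)=r_ix+d_i$ on $\mathbb{R}$, $i\in\mathcal{I}$, with $0<|r_i|<1$ and $\#\mathcal{I}\ge 2$. Its attractor $K$ is the unique non-empty compact set with $K=\bigcup_{i}S_i(K)$. Standing assumptions: $K$ is not a singleton and (normalization) the convex hull of $K$ is $[0,1]$. Given $\mathbf p=(p_i)_{i\in\mathcal I}$ with $p_i>0$, $\sum p_i=1$, the associated self-similar measure $\mu_{\mathbf p}$ is the unique Borel probability measure with $\mu_{\mathbf p}(E)=\sum_i p_i\mu_{\mathbf p}(S_i^{-1}(E))$ for all Borel $E$. $\mathcal{I}^*$ is the set of finite words; for $\sigma=(\sigma_1,\dots,\sigma_n)$, $S_\sigma=S_{\sigma_1}\circ\cdots\circ S_{\sigma_n}$, $r_\sigma=\prod r_{\sigma_k}$, $p_\sigma=\prod p_{\sigma_k}$, and $\sigma^-$ is $\sigma$ with the last letter deleted; for the empty word $S_\emptyset=\mathrm{id}$, $r_\emptyset=p_\emptyset=1$. For $t>0$, $\Lambda_t=\{\sigma\in\mathcal I^*:|r_\sigma|<t\le|r_{\sigma^-}|\}$ (convention: $|r_{\emptyset^-}|=\infty$, so $\Lambda_t=\{\emptyset\}$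 for $t>1$). Net intervals. For $t>0$ let $h_1<\dots<h_{s(t)}$ be the distinct elements of $\{S_\sigma(0),S_\sigma(1):\sigma\in\Lambda_t\}$. The net intervals of generation $t$ are the elements of $\mathcal{F}_t=\{[h_j,h_{j+1}]:1\le j<s(t),\ (h_j,h_{j+1})\cap K\ne\emptyset\}$. A net interval is always considered together with its generation. $T_\Delta(x)=rx+a$ is the map with $r>0$ and $T_\Delta([0,1])=\Delta$. For $\Delta\in\mathcal F_t$, a neighbour of $\Delta$ is a map $f=T_\Delta^{-1}\circ S_\sigma$ with $\sigma\in\Lambda_t$ and $S_\sigma(K)\cap\Delta^\circ\ne\emptyset$; one says that $\sigma$ generates $f$. The neighbour set $\mathcal V(\Delta)=\mathcal V_t(\Delta)$ is the set of all distinct neighbours of $\Delta$. The transition generation is $\operatorname{tg}(\Delta)=\operatorname{diam}(\Delta)\cdot\max\{|R|:(x\mapsto Rx+a)\in\mathcal V(\Delta)\}$; the children of $\Delta$ are the net intervals of generation $\operatorname{tg}(\Delta)$ contained in $\Delta$ (considered with generation $\operatorname{tg}(\Delta)$), and $\Delta$ is their parent. The position index of a child $\Delta'=[a',b']$ of $\Delta=[a,b]$ is $q(\Delta,\Delta')=(a'-a)/\operatorname{diam}(\Delta)$. Transition graph. $\mathcal G$ is the directed graph (loops, multiple edges allowed) with vertices the distinct neighbour sets of net intervals, and with an edge $(\mathcal V(\Delta),\mathcal V(\Delta'),q(\Delta,\Delta'))$ from $\mathcal V(\Delta)$ to $\mathcal V(\Delta')$ for each net interval $\Delta$ and child $\Delta'$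 of $\Delta$. An admissible path is a sequence of edges $\eta=(e_1,\dots,e_m)$, the target of $e_i$ being the source of $e_{i+1}$. The sequence of net intervals $(\Delta_i)_{i=0}^m$ realizes $\eta$ if each $\Delta_i$ is a child of $\Delta_{i-1}$ and $e_i=(\mathcal V(\Delta_{i-1}),\mathcal V(\Delta_i),q(\Delta_{i-1},\Delta_i))$. Transition matrices. Fix a total order on the set of all neighbours of net intervals. Let $e=(\mathcal V(\Delta),\mathcal V(\Delta'),q(\Delta,\Delta'))$ be an edge with $\Delta$ the parent of $\Delta'$, $\mathcal V(\Delta)=\{f_1<\dots<f_k\}$, $\mathcal V(\Delta')=\{g_1<\dots<g_n\}$. The transition matrix $T(e)$ is the $k\times n$ matrix with $$T(e)_{i,j}=\frac{\mu_{\mathbf p}(g_j^{-1}((0,1)))}{\mu_{\mathbf p}(f_i^{-1}((0,1)))}\,p_\ell$$ if there is $\ell\in\mathcal I\cup\{\emptyset\}$ such that $f_i$ is generated by some $\sigma$ and $g_j$ is generated by $\sigma\ell$, and $T(e)_{i,j}=0$ otherwise. (This depends only on $e$; the denominators are positive.) For $\eta=(e_1,\dots,e_m)$, $T(\eta)=T(e_1)\cdots T(e_m)$. Vector form. For $\Delta\in\mathcal F_t$ with $\mathcal V(\Delta)=\{f_1<\dots<f_k\}$, $\boldsymbol\mu(\Delta)=(q_1,\dots,q_k)$ is the row vector with $q_i=\mu_{\mathbf p}(f_i^{-1}((0,1)))\sum p_\sigma$, the sum being over all $\sigma\in\Lambda_t$ generating $f_i$. *)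

theory Defs
  imports "HOL-Probability.Probability" "Jordan_Normal_Form.Matrix"
begin

text \<open>
  A net interval is always paired with its generation; the pair \<open>(t, \<Delta>)\<close> stands for the
  net interval \<open>\<Delta>\<close> of generation \<open>t\<close>.
\<close>

type_synonym gen_interval = "real \<times> real set"

text \<open>
  Edges are triples (source, target, position index). Neighbours, being affine maps, are
  represented as functions.
\<close>

type_synonym edge = "(real \<Rightarrow> real) set \<times> (real \<Rightarrow> real) set \<times> real"

definition source :: "edge \<Rightarrow> (real \<Rightarrow> real) set" where
  "source e = fst e"

definition target :: "edge \<Rightarrow> (real \<Rightarrow> real) set" where
  "target e = fst (snd e)"

definition sim :: "('i \<Rightarrow> real) \<Rightarrow> ('i \<Rightarrow> real) \<Rightarrow> 'i \<Rightarrow> real \<Rightarrow> real" where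
  "sim r d i = (\<lambda>x. r i * x + d i)"

definition norm_map :: "real set \<Rightarrow> real \<Rightarrow> real" where
  "norm_map \<Delta> = (\<lambda>x. diameter \<Delta> * x + Inf \<Delta>)"

text \<open>
  The attractor is a parameter \<open>K\<close>, determined uniquely by the assumptions \<open>compact_K\<close>,
  \<open>nonempty_K\<close> and \<open>invariant_K\<close>.
\<close>

locale ifs =
  fixes I :: "'i set" and r d :: "'i \<Rightarrow> real" and K :: "real set"
  assumes finite_I: "finite I"
    and card_I: "card I \<ge> 2"
    and ratio_nonzero: "i \<in> I \<Longrightarrow> 0 < \<bar>r i\<bar>"
    and ratio_less_1: "i \<in> I \<Longrightarrow> \<bar>r i\<bar> < 1"
    and distinct_maps: "inj_on (sim r d) I"
    and compact_K: "compact K"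
    and nonempty_K: "K \<noteq> {}"
    and invariant_K: "K = (\<Union>i\<in>I. sim r d i ` K)"
    and not_singleton_K: "\<nexists>x. K = {x}"
    and hull_K: "convex hull K = {0..1}"
begin

definition S_word :: "'i list \<Rightarrow> real \<Rightarrow> real" where
  "S_word \<sigma> = foldr (\<lambda>i f. sim r d i \<circ> f) \<sigma> id"

definition r_word :: "'i list \<Rightarrow> real" where
  "r_word \<sigma> = prod_list (map r \<sigma>)"

text \<open>The disjunct \<open>\<sigma> = []\<close> encodes the convention \<open>\<bar>r\<^bsub>\<emptyset>\<^sup>-\<^esub>\<bar> = \<infinity>\<close>.\<close>

definition cut_words :: "real \<Rightarrow> 'i list set" where
  "cut_words t = {\<sigma> \<in> lists I. \<bar>r_word \<sigma>\<bar> < t \<and> (\<sigma> = [] \<or> t \<le> \<bar>r_word (butlast \<sigma>)\<bar>)}"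

definition endpoints :: "real \<Rightarrow> real list" where
  "endpoints t = sorted_list_of_set (\<Union>\<sigma>\<in>cut_words t. {S_word \<sigma> 0, S_word \<sigma> 1})"

definition net_intervals :: "real \<Rightarrow> real set set" where
  "net_intervals t =
     {{endpoints t ! j .. endpoints t ! Suc j} | j.
        Suc j < length (endpoints t) \<and> {endpoints t ! j <..< endpoints t ! Suc j} \<inter> K \<noteq> {}}"

definition is_net_interval :: "gen_interval \<Rightarrow> bool" where
  "is_net_interval N \<longleftrightarrow> fst N > 0 \<and> snd N \<in> net_intervals (fst N)"

definition generates :: "gen_interval \<Rightarrow> 'i list \<Rightarrow> (real \<Rightarrow> real) \<Rightarrow> bool" where
  "generates N \<sigma> f \<longleftrightarrow>
     \<sigma> \<in> cut_words (fst N) \<and> S_word \<sigma> ` K \<inter> interior (snd N) \<noteq> {} \<and>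
     f = inv_into UNIV (norm_map (snd N)) \<circ> S_word \<sigma>"

definition neighbour_set :: "gen_interval \<Rightarrow> (real \<Rightarrow> real) set" where
  "neighbour_set N = {f. \<exists>\<sigma>. generates N \<sigma> f}"

definition all_neighbours :: "(real \<Rightarrow> real) set" where
  "all_neighbours = (\<Union>N\<in>{N. is_net_interval N}. neighbour_set N)"

definition trans_gen :: "gen_interval \<Rightarrow> real" where
  "trans_gen N =
     diameter (snd N) * Max {\<bar>R\<bar> | R a. (\<lambda>x. R * x + a) \<in> neighbour_set N}"

definition is_child :: "gen_interval \<Rightarrow> gen_interval \<Rightarrow> bool" where
  "is_child N N' \<longleftrightarrow>
     is_net_interval N \<and> is_net_interval N' \<and> fst N' = trans_gen N \<and> snd N' \<subseteq> snd N"

definition position_index :: "gen_interval \<Rightarrow> gen_interval \<Rightarrow> real" where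
  "position_index N N' = (Inf (snd N') - Inf (snd N)) / diameter (snd N)"

definition transition_edge :: "gen_interval \<Rightarrow> gen_interval \<Rightarrow> edge" where
  "transition_edge N N' = (neighbour_set N, neighbour_set N', position_index N N')"

definition transition_edges :: "edge set" where
  "transition_edges = {transition_edge N N' | N N'. is_child N N'}"

definition admissible_path :: "edge list \<Rightarrow> bool" where
  "admissible_path \<eta> \<longleftrightarrow>
     set \<eta> \<subseteq> transition_edges \<and> (\<forall>i. Suc i < length \<eta> \<longrightarrow> target (\<eta> ! i) = source (\<eta> ! Suc i))"

text \<open>Only the values \<open>N 0, \<dots>, N m\<close> matter, where \<open>m\<close> is the length of the path.\<close>

definition realizes :: "(nat \<Rightarrow> gen_interval) \<Rightarrow> edge list \<Rightarrow> bool" where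
  "realizes N \<eta> \<longleftrightarrow>
     (\<forall>i\<le>length \<eta>. is_net_interval (N i)) \<and>
     (\<forall>i<length \<eta>. is_child (N i) (N (Suc i)) \<and> \<eta> ! i = transition_edge (N i) (N (Suc i)))"

text \<open>
  The word \<open>w\<close> plays the role of \<open>\<ell> \<in> \<I> \<union> {\<emptyset>}\<close>: it is empty or consists of a single letter.
\<close>

definition extends_by ::
    "gen_interval \<Rightarrow> gen_interval \<Rightarrow> (real \<Rightarrow> real) \<Rightarrow> (real \<Rightarrow> real) \<Rightarrow> 'i list \<Rightarrow> bool" where
  "extends_by N N' f g w \<longleftrightarrow>
     w \<in> insert [] ((\<lambda>l. [l]) ` I) \<and> (\<exists>\<sigma>. generates N \<sigma> f \<and> generates N' (\<sigma> @ w) g)"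

end

text \<open>
  The self-similar measure \<open>M\<close> is likewise a parameter, determined uniquely by being a Borel
  probability measure with \<open>self_similar\<close>. The relation \<open>ord\<close> is the fixed total order on
  neighbours.
\<close>

locale self_similar_measure = ifs I r d K
  for I :: "'i set" and r d :: "'i \<Rightarrow> real" and K :: "real set" +
  fixes p :: "'i \<Rightarrow> real" and M :: "real measure"
    and ord :: "(real \<Rightarrow> real) rel"
  assumes p_pos: "i \<in> I \<Longrightarrow> p i > 0"
    and p_sum: "(\<Sum>i\<in>I. p i) = 1"
    and prob_M: "prob_space M"
    and sets_M: "sets M = sets borel"
    and self_similar:
      "E \<in> sets borel \<Longrightarrow> measure M E = (\<Sum>i\<in>I. p i * measure M (sim r d i -` E))"
    and linear_ord: "linear_order_on all_neighbours ord"
begin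

definition p_word :: "'i list \<Rightarrow> real" where
  "p_word \<sigma> = prod_list (map p \<sigma>)"

definition weight :: "(real \<Rightarrow> real) \<Rightarrow> real" where
  "weight f = measure M (f -` {0<..<1})"

definition ordered :: "(real \<Rightarrow> real) set \<Rightarrow> (real \<Rightarrow> real) list" where
  "ordered V = (THE fs. set fs = V \<and> sorted_wrt (\<lambda>f g. (f, g) \<in> ord \<and> f \<noteq> g) fs)"

text \<open>
  The transition matrix is a function of the edge alone: a pair (parent, child) inducing the edge
  is chosen arbitrarily. The letter in each entry is unique, since the maps are distinct.
\<close>

definition transition_matrix :: "edge \<Rightarrow> real mat" where
  "transition_matrix e =
     (let (N, N') = (SOME (N, N'). is_child N N' \<and> e = transition_edge N N');
          fs = ordered (source e);
          gs = ordered (target e)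
      in mat (length fs) (length gs) (\<lambda>(i, j).
           if \<exists>w. extends_by N N' (fs ! i) (gs ! j) w
           then weight (gs ! j) / weight (fs ! i)
                  * p_word (THE w. extends_by N N' (fs ! i) (gs ! j) w)
           else 0))"

text \<open>
  The product of the transition matrices along a path starting at the vertex \<open>V\<close>. The vertex only
  serves to give the size of the identity matrix when the path is empty.
\<close>

fun path_matrix :: "(real \<Rightarrow> real) set \<Rightarrow> edge list \<Rightarrow> real mat" where
  "path_matrix V [] = 1\<^sub>m (card V)"
| "path_matrix V (e # \<eta>) = transition_matrix e * path_matrix (target e) \<eta>"

text \<open>Row vectors are matrices with one row.\<close>

definition measure_vector :: "gen_interval \<Rightarrow> real mat" where
  "measure_vector N =
     (let fs = ordered (neighbour_set N)
      in mat 1 (length fs) (\<lambda>(_, j).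
           weight (fs ! j) * (\<Sum>\<sigma> | generates N \<sigma> (fs ! j). p_word \<sigma>)))"

end

end

theory Submission
  imports Defs
begin

text \<open>
  Let \<open>\<Delta>'\<close> be a child of \<open>\<Delta>\<close>. The transition generation is chosen so that every word of
  \<open>\<Delta>'\<close> is, in a unique way, a word \<open>\<sigma>\<close> of \<open>\<Delta>\<close> followed by at most one letter: no letter if the
  ratio of the neighbour \<open>f\<close> generated by \<open>\<sigma>\<close> is below the maximum, one letter otherwise. Whether the
  continuation \<open>w\<close> of \<open>\<sigma>\<close> generates a given neighbour \<open>g\<close> of \<open>\<Delta>'\<close> is decided by the identity
  \<open>T\<^bsub>\<Delta>'\<^esub> \<circ> g = T\<^bsub>\<Delta>\<^esub> \<circ> f \<circ> S\<^bsub>w\<^esub>\<close>, hence by \<open>f\<close> alone, so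
  multiplying by \<open>T(e)\<close> regroups the sum over the words of \<open>\<Delta>'\<close> by their prefixes. The claim for
  paths follows by associativity.
\<close>

section \<open>Strictly sorted lists with respect to a linear order\<close>

text \<open>By asymmetry the two heads must agree, since otherwise each would precede the other.
  This is the uniqueness half of the \<open>THE\<close> in \<open>ordered\<close>.\<close>

lemma sorted_wrt_strict_unique:
  assumes "asymp P" "sorted_wrt P xs" "sorted_wrt P ys" "set xs = set ys"
  shows "xs = ys"
  using assms(2-)
proof (induction xs arbitrary: ys)
  case Nil
  then show ?case by simp
next
  case (Cons x xs)
  have irr: "\<not> P z z" for z
    using assms(1) by (meson asympD)
  obtain y ys' where ys: "ys = y # ys'"
    using Cons.prems(3) by (cases ys) auto
  have xy: "x = y"
  proof (rule ccontr)
    assume "x \<noteq> y"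
    then have "P x y" "P y x"
      using Cons.prems by (auto simp: ys)
    then show False
      using assms(1) by (meson asympD)
  qed
  have "x \<notin> set xs" "y \<notin> set ys'"
    using Cons.prems irr by (auto simp: ys)
  then have "set xs = set ys'"
    using Cons.prems(3) xy by (auto simp: ys)
  then show ?case
    using Cons.IH[of ys'] Cons.prems xy by (auto simp: ys)
qed

text \<open>Existence half of the \<open>THE\<close> in \<open>ordered\<close>, by inserting one
  element at a time: totality on \<open>A\<close> puts each old element into exactly one of the
  lists \<open>L\<close> and \<open>U\<close>.\<close>

lemma linear_order_list_exists:
  assumes "linear_order_on A R" "finite V" "V \<subseteq> A"
  shows "\<exists>fs. set fs = V \<and> sorted_wrt (\<lambda>f g. (f, g) \<in> R \<and> f \<noteq> g) fs"
  using assms(2,3)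
proof (induction V rule: finite_induct)
  case empty
  then show ?case by (intro exI[of _ "[]"]) auto
next
  case (insert x V)
  let ?P = "\<lambda>f g. (f, g) \<in> R \<and> f \<noteq> g"
  obtain fs where fs: "set fs = V" "sorted_wrt ?P fs"
    using insert by auto
  have tr: "trans R" and an: "antisym R" and tot: "total_on A R"
    using assms(1) by (auto simp: linear_order_on_def partial_order_on_def preorder_on_def)
  define L where "L = filter (\<lambda>f. ?P f x) fs"
  define U where "U = filter (\<lambda>f. ?P x f) fs"
  have tP: "?P f h" if "?P f g" "?P g h" for f g h
    using that tr an by (metis antisymD transD)
  have "set (L @ x # U) = insert x V"
    using fs(1) insert tot by (auto simp: L_def U_def total_on_def)
  moreover have "sorted_wrt ?P (L @ x # U)"
  proof -
    have "sorted_wrt ?P L" "sorted_wrt ?P U"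
      using fs(2) by (simp_all add: L_def U_def sorted_wrt_filter)
    moreover have "?P f x" if "f \<in> set L" for f
      using that by (auto simp: L_def)
    moreover have "?P x g" if "g \<in> set U" for g
      using that by (auto simp: U_def)
    moreover have "?P f g" if "f \<in> set L" "g \<in> set U" for f g
      using that tP[of f x g] by (auto simp: L_def U_def)
    ultimately show ?thesis
      by (auto simp: sorted_wrt_append)
  qed
  ultimately show ?case by blast
qed

lemma abs_prod_list_le_power:
  fixes h :: "'a \<Rightarrow> real"
  assumes "\<And>i. i \<in> set xs \<Longrightarrow> \<bar>h i\<bar> \<le> c"
  shows "\<bar>prod_list (map h xs)\<bar> \<le> c ^ length xs"
  using assms
proof (induction xs)
  case (Cons a xs)
  have "\<bar>h a\<bar> * \<bar>prod_list (map h xs)\<bar> \<le> c * c ^ length xs"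
    using Cons by (intro mult_mono) (auto intro: order_trans[OF abs_ge_zero])
  then show ?case by (simp add: abs_mult)
qed simp

section \<open>Words, their maps and their ratios\<close>

context ifs
begin

lemma S_word_append: "S_word (\<sigma> @ \<tau>) = S_word \<sigma> \<circ> S_word \<tau>"
  by (induction \<sigma>) (auto simp: S_word_def fun_eq_iff)

lemma r_word_append: "r_word (\<sigma> @ \<tau>) = r_word \<sigma> * r_word \<tau>"
  by (simp add: r_word_def)

lemma S_word_Nil: "S_word [] = id"
  by (simp add: S_word_def)

lemma S_word_single: "S_word [i] = sim r d i"
  by (simp add: S_word_def)

lemma S_word_affine: "S_word \<sigma> x = r_word \<sigma> * x + S_word \<sigma> 0"
proof (induction \<sigma> arbitrary: x)
  case Nil
  then show ?case by (simp add: S_word_def r_word_def)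
next
  case (Cons a \<sigma>)
  have eq: "S_word (a # \<sigma>) y = r a * S_word \<sigma> y + d a" for y
    by (simp add: S_word_def sim_def)
  have "S_word (a # \<sigma>) x = r a * (r_word \<sigma> * x + S_word \<sigma> 0) + d a"
    unfolding eq by (subst Cons.IH) simp
  also have "\<dots> = r_word (a # \<sigma>) * x + S_word (a # \<sigma>) 0"
    unfolding eq by (simp add: r_word_def algebra_simps)
  finally show ?case .
qed

lemma r_word_nonzero: "\<sigma> \<in> lists I \<Longrightarrow> r_word \<sigma> \<noteq> 0"
  using ratio_nonzero by (induction \<sigma>) (auto simp: r_word_def)

lemma abs_r_word_le_1:
  assumes "\<sigma> \<in> lists I"
  shows "\<bar>r_word \<sigma>\<bar> \<le> 1"
proof -
  have "\<bar>r i\<bar> \<le> 1" if "i \<in> set \<sigma>" for i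
    using assms that ratio_less_1[of i] by auto
  from abs_prod_list_le_power[of \<sigma> r, OF this] show ?thesis
    by (simp add: r_word_def)
qed

lemma abs_r_word_less_1:
  assumes "\<sigma> \<in> lists I" "\<sigma> \<noteq> []"
  shows "\<bar>r_word \<sigma>\<bar> < 1"
proof -
  obtain i \<tau> where \<sigma>: "\<sigma> = i # \<tau>"
    using assms(2) by (cases \<sigma>) auto
  have "\<bar>r i\<bar> * \<bar>r_word \<tau>\<bar> \<le> \<bar>r i\<bar> * 1"
    using assms \<sigma> by (intro mult_left_mono abs_r_word_le_1) auto
  also have "\<dots> < 1"
    using assms \<sigma> ratio_less_1 by auto
  finally show ?thesis
    by (simp add: \<sigma> r_word_def abs_mult)
qed

lemma abs_r_word_append_le:
  assumes "\<sigma> @ \<tau> \<in> lists I"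
  shows "\<bar>r_word (\<sigma> @ \<tau>)\<bar> \<le> \<bar>r_word \<sigma>\<bar>"
  using assms abs_r_word_le_1[of \<tau>] by (auto simp: r_word_append abs_mult mult_left_le)

lemma ratio_bound: "\<exists>c. 0 \<le> c \<and> c < 1 \<and> (\<forall>i\<in>I. \<bar>r i\<bar> \<le> c)"
proof -
  have "I \<noteq> {}"
    using card_I by auto
  then have "Max ((\<lambda>i. \<bar>r i\<bar>) ` I) \<in> (\<lambda>i. \<bar>r i\<bar>) ` I"
    using finite_I by (intro Max_in) auto
  moreover have "\<forall>i\<in>I. \<bar>r i\<bar> \<le> Max ((\<lambda>i. \<bar>r i\<bar>) ` I)"
    using finite_I by auto
  ultimately show ?thesis
    using ratio_less_1 by (metis (no_types, lifting) abs_ge_zero imageE)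
qed

text \<open>Finiteness of \<open>I\<close> gives one bound \<open>c < 1\<close> for all ratios, so
  the decay is uniform over all words of a given length.\<close>

lemma r_word_small:
  assumes "t > 0"
  shows "\<exists>n. \<forall>\<sigma>\<in>lists I. length \<sigma> \<ge> n \<longrightarrow> \<bar>r_word \<sigma>\<bar> < t"
proof -
  obtain c where c: "0 \<le> c" "c < 1" "\<forall>i\<in>I. \<bar>r i\<bar> \<le> c"
    using ratio_bound by blast
  obtain n where n: "c ^ n < t"
    using real_arch_pow_inv[OF assms c(2)] by blast
  have "\<bar>r_word \<sigma>\<bar> < t" if "\<sigma> \<in> lists I" "length \<sigma> \<ge> n" for \<sigma>
  proof -
    have "\<bar>r_word \<sigma>\<bar> \<le> c ^ length \<sigma>"
      unfolding r_word_def
      using abs_prod_list_le_power[of \<sigma> r c] c that by auto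
    also have "\<dots> \<le> c ^ n"
      using c that by (intro power_decreasing) auto
    finally show ?thesis
      using n by simp
  qed
  then show ?thesis by blast
qed

section \<open>Cut words: finiteness and unique prefixes\<close>

lemma finite_cut_words:
  assumes "t > 0"
  shows "finite (cut_words t)"
proof -
  obtain n where n: "\<And>\<sigma>. \<sigma> \<in> lists I \<Longrightarrow> length \<sigma> \<ge> n \<Longrightarrow> \<bar>r_word \<sigma>\<bar> < t"
    using r_word_small[OF assms] by blast
  \<comment> \<open>A longer word still has at least \<open>n\<close> letters after losing its last
    one, so \<open>butlast \<sigma>\<close> would already have ratio below \<open>t\<close>.\<close>
  have "length \<sigma> \<le> n" if \<sigma>: "\<sigma> \<in> cut_words t" for \<sigma>
  proof (rule ccontr)
    assume len: "\<not> length \<sigma> \<le> n"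
    have "butlast \<sigma> \<in> lists I"
      using \<sigma> by (auto simp: cut_words_def dest: in_set_butlastD)
    then have "\<bar>r_word (butlast \<sigma>)\<bar> < t"
      using len by (intro n) auto
    then show False
      using \<sigma> len by (auto simp: cut_words_def)
  qed
  then have "cut_words t \<subseteq> {\<sigma>. set \<sigma> \<subseteq> I \<and> length \<sigma> \<le> n}"
    by (auto simp: cut_words_def)
  then show ?thesis
    using finite_lists_length_le[OF finite_I] finite_subset by blast
qed

text \<open>The prefix is the shortest one with ratio below \<open>t\<close>. Induction from the
  right finds it: either the word without its last letter is small enough already, or the whole word
  is cut.\<close>

lemma cut_words_prefix_exists:
  assumes "\<tau> \<in> lists I" "\<bar>r_word \<tau>\<bar> < t"
  shows "\<exists>\<sigma> w. \<tau> = \<sigma> @ w \<and> \<sigma> \<in> cut_words t"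
  using assms
proof (induction \<tau> rule: rev_induct)
  case Nil
  then show ?case by (auto simp: cut_words_def)
next
  case (snoc i \<tau>)
  show ?case
  proof (cases "\<bar>r_word \<tau>\<bar> < t")
    case True
    then obtain \<sigma> w where "\<tau> = \<sigma> @ w" "\<sigma> \<in> cut_words t"
      using snoc by auto
    then show ?thesis
      by (intro exI[of _ \<sigma>] exI[of _ "w @ [i]"]) auto
  next
    case False
    then show ?thesis
      using snoc.prems by (intro exI[of _ "\<tau> @ [i]"] exI[of _ "[]"]) (auto simp: cut_words_def)
  qed
qed

lemma cut_words_extension_Nil:
  assumes "\<sigma> @ w \<in> cut_words t" "\<bar>r_word \<sigma>\<bar> < t"
  shows "w = []"
proof (rule ccontr)
  assume w: "w \<noteq> []"
  have "\<sigma> @ butlast w \<in> lists I"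
    using assms(1) by (auto simp: cut_words_def dest: in_set_butlastD)
  then have "\<bar>r_word (\<sigma> @ butlast w)\<bar> \<le> \<bar>r_word \<sigma>\<bar>"
    by (rule abs_r_word_append_le)
  then show False
    using assms w by (auto simp: cut_words_def butlast_append)
qed

text \<open>Two prefixes of one word are comparable, and a cut word has no proper extension that is
  cut for the same \<open>t\<close>. This makes the regrouping by prefixes injective.\<close>

lemma cut_words_prefix_unique:
  assumes "\<sigma> \<in> cut_words t" "\<sigma>' \<in> cut_words t" "\<sigma> @ w = \<sigma>' @ w'"
  shows "\<sigma> = \<sigma>'"
proof -
  obtain u where "\<sigma>' = \<sigma> @ u \<or> \<sigma> = \<sigma>' @ u"
    using assms(3) by (auto simp: append_eq_append_conv2)
  then show ?thesis
    using assms(1,2) cut_words_extension_Nil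
    by (metis (no_types, lifting) append_Nil2 cut_words_def mem_Collect_eq)
qed

section \<open>Cylinders of the attractor\<close>

lemma S_word_image_subset: "w \<in> lists I \<Longrightarrow> S_word w ` K \<subseteq> K"
proof (induction w)
  case Nil
  then show ?case by (simp add: S_word_Nil)
next
  case (Cons i w)
  have "S_word (i # w) ` K = sim r d i ` S_word w ` K"
    using S_word_append[of "[i]" w] by (simp add: S_word_single image_comp)
  also have "\<dots> \<subseteq> sim r d i ` K"
    using Cons by auto
  also have "\<dots> \<subseteq> K"
    using invariant_K Cons by auto
  finally show ?case .
qed

lemma S_word_append_image_subset:
  "w \<in> lists I \<Longrightarrow> S_word (\<sigma> @ w) ` K \<subseteq> S_word \<sigma> ` K"
  using S_word_image_subset[of w] by (auto simp: S_word_append)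

lemma words_cover:
  "x \<in> K \<Longrightarrow> \<exists>\<sigma>\<in>lists I. length \<sigma> = n \<and> x \<in> S_word \<sigma> ` K"
proof (induction n arbitrary: x)
  case 0
  then show ?case by (intro bexI[of _ "[]"]) (auto simp: S_word_Nil)
next
  case (Suc n)
  obtain i y where i: "i \<in> I" "y \<in> K" "x = sim r d i y"
    using Suc.prems invariant_K by blast
  obtain \<sigma> where "\<sigma> \<in> lists I" "length \<sigma> = n" "y \<in> S_word \<sigma> ` K"
    using Suc.IH[OF i(2)] by blast
  then show ?case
    using i S_word_append[of "[i]" \<sigma>]
    by (intro bexI[of _ "i # \<sigma>"]) (auto simp: S_word_single)
qed

lemma cut_words_cover:
  assumes "t > 0" "x \<in> K"
  shows "\<exists>\<sigma>\<in>cut_words t. x \<in> S_word \<sigma> ` K"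
proof -
  obtain n where n: "\<And>\<sigma>. \<sigma> \<in> lists I \<Longrightarrow> length \<sigma> \<ge> n \<Longrightarrow> \<bar>r_word \<sigma>\<bar> < t"
    using r_word_small[OF assms(1)] by blast
  obtain \<tau> where \<tau>: "\<tau> \<in> lists I" "length \<tau> = n" "x \<in> S_word \<tau> ` K"
    using words_cover[OF assms(2)] by blast
  obtain \<sigma> w where "\<tau> = \<sigma> @ w" "\<sigma> \<in> cut_words t"
    using cut_words_prefix_exists[OF \<tau>(1), of t] n[of \<tau>] \<tau> by auto
  then show ?thesis
    using \<tau> S_word_append_image_subset[of w \<sigma>] by (intro bexI[of _ \<sigma>]) auto
qed

text \<open>Extreme points of a convex hull belong to the set itself, and 0 and 1 are extreme in the
  hull of \<open>K\<close>.\<close>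

lemma endpoints_in_K: "0 \<in> K" "1 \<in> K"
proof -
  have K: "K \<subseteq> {0..1}"
    using hull_subset[of K convex] hull_K by simp
  have ex: "x \<in> K" if "x extreme_point_of {0..1::real}" for x
    using extreme_point_of_convex_hull[of x K] that hull_K by simp
  show "0 \<in> K" "1 \<in> K"
    by (rule ex, auto simp: extreme_point_of_def open_segment_eq_real_ivl split: if_splits)+
qed

section \<open>Net intervals, normalization and neighbours\<close>

lemma net_interval_cases:
  assumes "is_net_interval N"
  obtains a b where "a < b" "snd N = {a..b}" "{a<..<b} \<inter> K \<noteq> {}"
    "b \<in> (\<Union>\<sigma>\<in>cut_words (fst N). {S_word \<sigma> 0, S_word \<sigma> 1})"
    "{a<..<b} \<inter> (\<Union>\<sigma>\<in>cut_words (fst N). {S_word \<sigma> 0, S_word \<sigma> 1}) = {}"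
proof -
  let ?E = "\<Union>\<sigma>\<in>cut_words (fst N). {S_word \<sigma> 0, S_word \<sigma> 1}"
  let ?es = "endpoints (fst N)"
  have "fst N > 0"
    using assms by (simp add: is_net_interval_def)
  then have set_es: "set ?es = ?E" and sorted: "sorted ?es" and dist: "distinct ?es"
    using finite_cut_words by (auto simp: endpoints_def)
  obtain j where j: "Suc j < length ?es" "snd N = {?es ! j .. ?es ! Suc j}"
    "{?es ! j <..< ?es ! Suc j} \<inter> K \<noteq> {}"
    using assms by (auto simp: is_net_interval_def net_intervals_def)
  have "?es ! j < ?es ! Suc j"
    using sorted_nth_mono[OF sorted, of j "Suc j"] j(1) dist
    by (auto simp: nth_eq_iff_index_eq less_le)
  moreover have "?es ! Suc j \<in> ?E"
    using set_es j(1) nth_mem by blast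
  moreover have "{?es ! j <..< ?es ! Suc j} \<inter> ?E = {}"
  proof -
    have "x \<le> ?es ! j \<or> ?es ! Suc j \<le> x" if x: "x \<in> ?E" for x
    proof -
      obtain k where k: "k < length ?es" "x = ?es ! k"
        using x set_es by (metis in_set_conv_nth)
      then show ?thesis
        using sorted_nth_mono[OF sorted, of k j] sorted_nth_mono[OF sorted, of "Suc j" k] j(1)
        by (cases "k \<le> j") auto
    qed
    then show ?thesis by fastforce
  qed
  ultimately show ?thesis
    using j that by blast
qed

lemma norm_map_interval:
  fixes a b :: real
  assumes "a < b"
  shows "norm_map {a..b} = (\<lambda>x. (b - a) * x + a)"
    and "inv_into UNIV (norm_map {a..b}) = (\<lambda>y. (y - a) / (b - a))"
    and "bij (norm_map {a..b})"
proof -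
  show nm: "norm_map {a..b} = (\<lambda>x. (b - a) * x + a)"
    using assms by (simp add: norm_map_def)
  show "inv_into UNIV (norm_map {a..b}) = (\<lambda>y. (y - a) / (b - a))"
    unfolding nm using assms by (intro inv_equality) auto
  show "bij (norm_map {a..b})"
    unfolding nm using assms
    by (intro bij_betw_byWitness[where f' = "\<lambda>y. (y - a) / (b - a)"]) auto
qed

lemma net_interval_diameter_pos: "is_net_interval N \<Longrightarrow> diameter (snd N) > 0"
  by (erule net_interval_cases) simp

lemma net_interval_bij: "is_net_interval N \<Longrightarrow> bij (norm_map (snd N))"
  by (erule net_interval_cases) (simp add: norm_map_interval(3))

text \<open>Bijectivity of the normalization removes the inverse, leaving an equation that can be
  composed with further maps.\<close>

lemma generates_iff:
  assumes "is_net_interval N"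
  shows "generates N \<sigma> f \<longleftrightarrow>
    \<sigma> \<in> cut_words (fst N) \<and> S_word \<sigma> ` K \<inter> interior (snd N) \<noteq> {} \<and>
    S_word \<sigma> = norm_map (snd N) \<circ> f"
proof -
  have b: "bij (norm_map (snd N))"
    by (rule net_interval_bij[OF assms])
  have "f = inv_into UNIV (norm_map (snd N)) \<circ> S_word \<sigma> \<longleftrightarrow> S_word \<sigma> = norm_map (snd N) \<circ> f"
    using b by (metis bij_is_inj bij_is_surj comp_assoc comp_id fun.map_id id_comp inv_o_cancel surj_iff)
  then show ?thesis
    by (auto simp: generates_def)
qed

text \<open>For an affine map this is the linear coefficient; neighbours are bare functions, so it
  has to be read off from values.\<close>

definition slope :: "(real \<Rightarrow> real) \<Rightarrow> real" where
  "slope f = f 1 - f 0"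

lemma generates_slope:
  assumes "is_net_interval N" "generates N \<sigma> f"
  shows "\<bar>r_word \<sigma>\<bar> = diameter (snd N) * \<bar>slope f\<bar>"
    and "f = (\<lambda>x. slope f * x + f 0)"
proof -
  let ?D = "diameter (snd N)"
  have D: "?D > 0"
    by (rule net_interval_diameter_pos[OF assms(1)])
  have S: "S_word \<sigma> x = ?D * f x + Inf (snd N)" for x
    using assms generates_iff by (auto simp: norm_map_def)
  have S': "?D * f x + Inf (snd N) = r_word \<sigma> * x + (?D * f 0 + Inf (snd N))" for x
    using S_word_affine[of \<sigma> x] unfolding S .
  have r: "r_word \<sigma> = ?D * slope f"
    using S'[of 1] by (simp add: slope_def algebra_simps)
  then show "\<bar>r_word \<sigma>\<bar> = ?D * \<bar>slope f\<bar>"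
    using D by (simp add: abs_mult)
  show "f = (\<lambda>x. slope f * x + f 0)"
  proof
    fix x
    have "?D * f x = ?D * (slope f * x + f 0)"
      using S'[of x] r by (simp add: algebra_simps)
    then show "f x = slope f * x + f 0"
      using D by simp
  qed
qed

lemma finite_generates: "is_net_interval N \<Longrightarrow> finite {\<sigma>. generates N \<sigma> f}"
  by (rule finite_subset[OF _ finite_cut_words[of "fst N"]])
    (auto simp: generates_def is_net_interval_def)

lemma finite_neighbour_set:
  assumes "is_net_interval N"
  shows "finite (neighbour_set N)"
proof -
  have "neighbour_set N \<subseteq>
      (\<lambda>\<sigma>. inv_into UNIV (norm_map (snd N)) \<circ> S_word \<sigma>) ` cut_words (fst N)"
    by (auto simp: neighbour_set_def generates_def)
  then show ?thesis
    using finite_cut_words[of "fst N"] assms finite_subset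
    by (fastforce simp: is_net_interval_def)
qed

text \<open>A point of \<open>K\<close> inside the net interval lies in the cylinder of some cut
  word, which then generates a neighbour.\<close>

lemma neighbour_set_nonempty:
  assumes "is_net_interval N"
  shows "neighbour_set N \<noteq> {}"
proof -
  obtain a b where ab: "a < b" "snd N = {a..b}" "{a<..<b} \<inter> K \<noteq> {}"
    by (rule net_interval_cases[OF assms]) blast
  obtain x where x: "x \<in> K" "x \<in> {a<..<b}"
    using ab(3) by blast
  obtain \<sigma> where "\<sigma> \<in> cut_words (fst N)" "x \<in> S_word \<sigma> ` K"
    using cut_words_cover[OF _ x(1), of "fst N"] assms by (auto simp: is_net_interval_def)
  then have "generates N \<sigma> (inv_into UNIV (norm_map (snd N)) \<circ> S_word \<sigma>)"
    using x ab(2) by (auto simp: generates_def)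
  then show ?thesis
    by (auto simp: neighbour_set_def)
qed

definition max_slope :: "(real \<Rightarrow> real) set \<Rightarrow> real" where
  "max_slope V = Max ((\<lambda>f. \<bar>slope f\<bar>) ` V)"

lemma trans_gen_eq:
  assumes "is_net_interval N"
  shows "trans_gen N = diameter (snd N) * max_slope (neighbour_set N)"
proof -
  have "{\<bar>R\<bar> | R a. (\<lambda>x. R * x + a) \<in> neighbour_set N} = (\<lambda>f. \<bar>slope f\<bar>) ` neighbour_set N"
  proof (intro equalityI subsetI)
    fix y assume "y \<in> {\<bar>R\<bar> | R a. (\<lambda>x. R * x + a) \<in> neighbour_set N}"
    then obtain R a where R: "y = \<bar>R\<bar>" "(\<lambda>x. R * x + a) \<in> neighbour_set N"
      by blast
    show "y \<in> (\<lambda>f. \<bar>slope f\<bar>) ` neighbour_set N"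
      by (rule image_eqI[OF _ R(2)]) (simp add: slope_def R)
  next
    fix y assume "y \<in> (\<lambda>f. \<bar>slope f\<bar>) ` neighbour_set N"
    then obtain f where f: "f \<in> neighbour_set N" "y = \<bar>slope f\<bar>"
      by blast
    then have "(\<lambda>x. slope f * x + f 0) \<in> neighbour_set N"
      using generates_slope(2)[OF assms] by (auto simp: neighbour_set_def)
    then show "y \<in> {\<bar>R\<bar> | R a. (\<lambda>x. R * x + a) \<in> neighbour_set N}"
      using f by blast
  qed
  then show ?thesis
    by (simp add: trans_gen_def max_slope_def)
qed

lemma slope_le_max_slope:
  assumes "is_net_interval N" "f \<in> neighbour_set N"
  shows "\<bar>slope f\<bar> \<le> max_slope (neighbour_set N)"
  using assms finite_neighbour_set[OF assms(1)] by (auto simp: max_slope_def)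

text \<open>The maximum is attained by a neighbour generated by some cut word \<sigma>; then
  \<open>trans_gen N\<close> equals the absolute ratio of \<sigma>, which is below
  \<open>fst N\<close>.\<close>

lemma trans_gen_less:
  assumes "is_net_interval N"
  shows "trans_gen N < fst N"
proof -
  have "max_slope (neighbour_set N) \<in> (\<lambda>f. \<bar>slope f\<bar>) ` neighbour_set N"
    unfolding max_slope_def using assms finite_neighbour_set neighbour_set_nonempty
    by (intro Max_in) auto
  then obtain f \<sigma> where "max_slope (neighbour_set N) = \<bar>slope f\<bar>" "generates N \<sigma> f"
    by (auto simp: neighbour_set_def)
  then show ?thesis
    using trans_gen_eq[OF assms] generates_slope(1)[OF assms, of \<sigma> f]
    by (auto simp: generates_def cut_words_def)
qed

section \<open>Passage to the transition generation\<close>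

text \<open>The words to append when passing to the transition generation. Phrasing this by slopes
  keeps it free of the generating word and of the net interval.\<close>

definition continuation :: "(real \<Rightarrow> real) set \<Rightarrow> (real \<Rightarrow> real) \<Rightarrow> 'i list \<Rightarrow> bool" where
  "continuation V f w \<longleftrightarrow>
     (if \<bar>slope f\<bar> < max_slope V then w = [] else w \<in> (\<lambda>i. [i]) ` I)"

lemma continuation_lists: "continuation V f w \<Longrightarrow> w \<in> insert [] ((\<lambda>i. [i]) ` I)"
  by (auto simp: continuation_def split: if_splits)

text \<open>After scaling by the diameter, slopes become ratios and the maximal slope becomes
  \<open>trans_gen N\<close>. A ratio below this value needs no letter; a ratio equal to it just
  misses the strict inequality, and one letter repairs that.\<close>

lemma append_in_cut_words_iff:
  assumes N: "is_net_interval N" and gen: "generates N \<sigma> f"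
  shows "\<sigma> @ w \<in> cut_words (trans_gen N) \<longleftrightarrow> continuation (neighbour_set N) f w"
proof -
  let ?t = "trans_gen N"
  let ?M = "max_slope (neighbour_set N)"
  have f: "f \<in> neighbour_set N"
    using gen by (auto simp: neighbour_set_def)
  have \<sigma>: "\<sigma> \<in> cut_words (fst N)" "\<sigma> \<in> lists I"
    using gen by (auto simp: generates_def cut_words_def)
  have D: "diameter (snd N) > 0"
    by (rule net_interval_diameter_pos[OF N])
  have less: "\<bar>slope f\<bar> < ?M \<longleftrightarrow> \<bar>r_word \<sigma>\<bar> < ?t" and le: "\<bar>r_word \<sigma>\<bar> \<le> ?t"
    using generates_slope(1)[OF N gen] trans_gen_eq[OF N] D slope_le_max_slope[OF N f]
    by auto
  show ?thesis
  proof (cases "\<bar>r_word \<sigma>\<bar> < ?t")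
    case True
    \<comment> \<open>The condition on \<open>butlast \<sigma>\<close> survives because the
      threshold has decreased.\<close>
    have "\<sigma> \<in> cut_words ?t"
      using True \<sigma> trans_gen_less[OF N] by (auto simp: cut_words_def)
    then show ?thesis
      using True less cut_words_extension_Nil[of \<sigma> w ?t] by (auto simp: continuation_def)
  next
    case False
    then have eq: "\<bar>r_word \<sigma>\<bar> = ?t"
      using le by simp
    have pos: "?t > 0"
      using eq r_word_nonzero[OF \<sigma>(2)] by auto
    have small: "\<bar>r_word (\<sigma> @ u)\<bar> < ?t" if "u \<in> lists I" "u \<noteq> []" for u
      using abs_r_word_less_1[OF that] eq pos by (simp add: r_word_append abs_mult)
    have "\<sigma> @ w \<in> cut_words ?t \<longleftrightarrow> w \<in> (\<lambda>i. [i]) ` I"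
    proof
      assume w: "\<sigma> @ w \<in> cut_words ?t"
      then have wI: "w \<in> lists I"
        by (auto simp: cut_words_def)
      have ne: "w \<noteq> []"
        using w eq by (auto simp: cut_words_def)
      have bI: "butlast w \<in> lists I"
        using wI by (auto dest: in_set_butlastD)
      \<comment> \<open>With two or more letters, the word without its last letter would already be
        below the threshold.\<close>
      have "butlast w = []"
        using small[OF bI] w ne by (auto simp: cut_words_def butlast_append)
      then have "w = [last w]"
        using ne by (metis append_butlast_last_id append_Nil)
      then show "w \<in> (\<lambda>i. [i]) ` I"
        using wI ne last_in_set by fastforce
    next
      assume "w \<in> (\<lambda>i. [i]) ` I"
      then obtain i where i: "w = [i]" "i \<in> I"
        by blast
      then show "\<sigma> @ w \<in> cut_words ?t"
        using \<sigma> small[of w] eq by (auto simp: cut_words_def)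
    qed
    then show ?thesis
      using False less by (auto simp: continuation_def)
  qed
qed

text \<open>A cut word of the smaller generation has a prefix cut at \<open>fst N\<close>; the
  cylinder of the prefix is larger, so it meets the interior too.\<close>

lemma cut_word_decompose:
  assumes N: "is_net_interval N" and \<tau>: "\<tau> \<in> cut_words (trans_gen N)"
    and meets: "S_word \<tau> ` K \<inter> interior (snd N) \<noteq> {}"
  shows "\<exists>\<sigma> w f. \<tau> = \<sigma> @ w \<and> generates N \<sigma> f \<and> continuation (neighbour_set N) f w"
proof -
  have "\<tau> \<in> lists I" "\<bar>r_word \<tau>\<bar> < fst N"
    using \<tau> trans_gen_less[OF N] by (auto simp: cut_words_def)
  then obtain \<sigma> w where sw: "\<tau> = \<sigma> @ w" "\<sigma> \<in> cut_words (fst N)"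
    using cut_words_prefix_exists by blast
  have "w \<in> lists I"
    using \<open>\<tau> \<in> lists I\<close> sw by auto
  then have "S_word \<sigma> ` K \<inter> interior (snd N) \<noteq> {}"
    using S_word_append_image_subset[of w \<sigma>] sw meets by blast
  then have "generates N \<sigma> (inv_into UNIV (norm_map (snd N)) \<circ> S_word \<sigma>)"
    using sw by (simp add: generates_def)
  then show ?thesis
    using append_in_cut_words_iff[OF N] sw \<tau> by blast
qed

section \<open>Words of a child in terms of its parent\<close>

lemma child_interior_subset:
  "is_child N N' \<Longrightarrow> interior (snd N') \<subseteq> interior (snd N)"
  by (simp add: is_child_def interior_mono)

text \<open>The condition of meeting the interior is automatic: the equation forces the map of
  \<open>\<sigma> @ w\<close> to equal that of any word known to generate \<open>g\<close>. The
  right-hand side no longer mentions \<sigma>.\<close>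

lemma generates_child_iff:
  assumes ch: "is_child N N'" and gen: "generates N \<sigma> f" and g: "g \<in> neighbour_set N'"
  shows "generates N' (\<sigma> @ w) g \<longleftrightarrow> continuation (neighbour_set N) f w \<and>
    norm_map (snd N') \<circ> g = norm_map (snd N) \<circ> f \<circ> S_word w"
proof -
  have N: "is_net_interval N" and N': "is_net_interval N'" and t: "fst N' = trans_gen N"
    using ch by (auto simp: is_child_def)
  obtain \<tau> where \<tau>: "generates N' \<tau> g"
    using g by (auto simp: neighbour_set_def)
  have S: "S_word (\<sigma> @ w) = norm_map (snd N) \<circ> f \<circ> S_word w"
    using gen generates_iff[OF N] by (auto simp: S_word_append)
  show ?thesis
    using generates_iff[OF N', of "\<sigma> @ w" g] generates_iff[OF N', of \<tau> g] \<tau> S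
      append_in_cut_words_iff[OF N gen, of w] t
    by auto
qed

lemma extends_by_iff:
  assumes ch: "is_child N N'" and f: "f \<in> neighbour_set N" and g: "g \<in> neighbour_set N'"
  shows "extends_by N N' f g w \<longleftrightarrow> continuation (neighbour_set N) f w \<and>
    norm_map (snd N') \<circ> g = norm_map (snd N) \<circ> f \<circ> S_word w"
proof -
  obtain \<sigma> where "generates N \<sigma> f"
    using f by (auto simp: neighbour_set_def)
  then show ?thesis
    using generates_child_iff[OF ch _ g] continuation_lists
    unfolding extends_by_def by blast
qed

text \<open>In normalized coordinates the endpoints of the next generation inside the parent depend
  only on the neighbour set. An endpoint in the interior is itself a point of the cylinder, because
  0 and 1 lie in \<open>K\<close>, so its word has a prefix generating a neighbour.\<close>

lemma child_endpoint_iff: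
  assumes N: "is_net_interval N" and y: "0 < y" "y < 1"
  shows "norm_map (snd N) y \<in> (\<Union>\<sigma>\<in>cut_words (trans_gen N). {S_word \<sigma> 0, S_word \<sigma> 1}) \<longleftrightarrow>
    (\<exists>f\<in>neighbour_set N. \<exists>w. continuation (neighbour_set N) f w \<and> y \<in> {f (S_word w 0), f (S_word w 1)})"
    (is "?L \<longleftrightarrow> ?R")
proof
  assume ?L
  then obtain \<tau> e where \<tau>: "\<tau> \<in> cut_words (trans_gen N)" "e \<in> {0, 1}"
    "norm_map (snd N) y = S_word \<tau> e"
    by blast
  obtain a b where ab: "a < b" "snd N = {a..b}"
    by (rule net_interval_cases[OF N]) blast
  have "(b - a) * y < (b - a) * 1" "(b - a) * y > 0"
    using ab(1) y by (auto intro!: mult_strict_left_mono)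
  then have "a < (b - a) * y + a" "(b - a) * y + a < b"
    by (simp_all only: mult_1_right)
  then have "norm_map (snd N) y \<in> interior (snd N)"
    using ab by (simp add: norm_map_interval)
  moreover have "e \<in> K"
    using endpoints_in_K \<tau> by auto
  ultimately have "S_word \<tau> ` K \<inter> interior (snd N) \<noteq> {}"
    using \<tau> by auto
  then obtain \<sigma> w f where *: "\<tau> = \<sigma> @ w" "generates N \<sigma> f" "continuation (neighbour_set N) f w"
    using cut_word_decompose[OF N \<tau>(1)] by blast
  have "norm_map (snd N) y = norm_map (snd N) (f (S_word w e))"
    using \<tau>(3) * generates_iff[OF N] by (auto simp: S_word_append)
  then have "y = f (S_word w e)"
    using net_interval_bij[OF N] by (auto dest: bij_is_inj injD)
  then show ?R
    using * \<tau>(2) by (auto simp: neighbour_set_def)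
next
  assume ?R
  then obtain f w e \<sigma> where *: "generates N \<sigma> f" "continuation (neighbour_set N) f w"
    "e \<in> {0, 1}" "y = f (S_word w e)"
    by (auto simp: neighbour_set_def)
  then have "\<sigma> @ w \<in> cut_words (trans_gen N)" "norm_map (snd N) y = S_word (\<sigma> @ w) e"
    using append_in_cut_words_iff[OF N *(1)] iffD1[OF generates_iff[OF N] *(1)]
    by (auto simp: S_word_append)
  then show ?L
    using *(3) by auto
qed

section \<open>Independence of the net intervals chosen for an edge\<close>

text \<open>
  The position index does not record the size of the child. It is nevertheless determined by the
  edge, since the right endpoint of the child is the next endpoint to the right of its left one,
  and the normalized endpoints inside the parent depend only on the neighbour set.
\<close>

lemma child_diameter_ratio_le:
  assumes ch: "is_child N N'" and ch0: "is_child N0 N0'"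
    and V: "neighbour_set N = neighbour_set N0"
    and q: "position_index N N' = position_index N0 N0'"
  shows "diameter (snd N0') / diameter (snd N0) \<le> diameter (snd N') / diameter (snd N)"
proof (rule ccontr)
  have NN: "is_net_interval N" "is_net_interval N0" "is_net_interval N'" "is_net_interval N0'"
    and t: "fst N' = trans_gen N" "fst N0' = trans_gen N0"
    and sub: "snd N' \<subseteq> snd N" "snd N0' \<subseteq> snd N0"
    using ch ch0 by (auto simp: is_child_def)
  let ?E = "\<lambda>t. \<Union>\<sigma>\<in>cut_words t. {S_word \<sigma> 0, S_word \<sigma> 1}"
  obtain a b where ab: "a < b" "snd N = {a..b}"
    by (rule net_interval_cases[OF NN(1)]) blast
  obtain a0 b0 where ab0: "a0 < b0" "snd N0 = {a0..b0}"
    by (rule net_interval_cases[OF NN(2)]) blast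
  obtain a' b' where ab': "a' < b'" "snd N' = {a'..b'}" "b' \<in> ?E (fst N')"
    by (rule net_interval_cases[OF NN(3)]) blast
  obtain a0' b0' where ab0': "a0' < b0'" "snd N0' = {a0'..b0'}" "{a0'<..<b0'} \<inter> ?E (fst N0') = {}"
    by (rule net_interval_cases[OF NN(4)]) blast
  \<comment> \<open>Normalized right endpoints \<open>y\<close> and \<open>y0\<close> of the two
    children; \<open>s\<close> is their common normalized left endpoint.\<close>
  define y where "y = (b' - a) / (b - a)"
  define y0 where "y0 = (b0' - a0) / (b0 - a0)"
  define s where "s = (a' - a) / (b - a)"
  have s0: "s = (a0' - a0) / (b0 - a0)"
    using q ab ab0 ab' ab0' by (simp add: position_index_def s_def)
  assume "\<not> ?thesis"
  then have lt: "(b' - a') / (b - a) < (b0' - a0') / (b0 - a0)"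
    using ab ab0 ab' ab0' by simp
  have ys: "(b' - a') / (b - a) = y - s" "(b0' - a0') / (b0 - a0) = y0 - s"
    by (simp add: y_def s_def flip: diff_divide_distrib)
      (simp add: y0_def s0 flip: diff_divide_distrib)
  have "y < y0"
    using lt ys by simp
  have "s \<ge> 0" "y > s" "y0 \<le> 1"
    using sub ab ab0 ab' ab0' by (auto simp: s_def y_def y0_def divide_strict_right_mono)
  then have y01: "0 < y" "y < 1"
    using \<open>y < y0\<close> by auto
  have "norm_map (snd N) y = b'"
    using ab by (simp add: norm_map_interval y_def)
  then have "norm_map (snd N0) y \<in> ?E (fst N0')"
    using ab' child_endpoint_iff[OF NN(1) y01] child_endpoint_iff[OF NN(2) y01] V t by simp
  moreover have "norm_map (snd N0) s = a0'" "norm_map (snd N0) y0 = b0'"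
    using ab0 by (simp_all add: norm_map_interval s0 y0_def)
  moreover have "norm_map (snd N0) s < norm_map (snd N0) y"
    "norm_map (snd N0) y < norm_map (snd N0) y0"
    using ab0 \<open>y > s\<close> \<open>y < y0\<close> by (simp_all add: norm_map_interval)
  ultimately show False
    using ab0' by auto
qed

lemma extends_by_cong:
  assumes ch: "is_child N N'" and ch0: "is_child N0 N0'"
    and e: "transition_edge N N' = transition_edge N0 N0'"
    and f: "f \<in> neighbour_set N" and g: "g \<in> neighbour_set N'"
  shows "extends_by N N' f g w \<longleftrightarrow> extends_by N0 N0' f g w"
proof -
  have V: "neighbour_set N = neighbour_set N0" "neighbour_set N' = neighbour_set N0'"
    and q: "position_index N N' = position_index N0 N0'"
    using e by (auto simp: transition_edge_def)
  have ratio: "diameter (snd N') / diameter (snd N) = diameter (snd N0') / diameter (snd N0)"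
    using child_diameter_ratio_le[OF ch ch0 V(1) q]
      child_diameter_ratio_le[OF ch0 ch V(1)[symmetric] q[symmetric]] by simp
  \<comment> \<open>Division by the diameter of the parent leaves only the ratio of diameters and
    the position index, both fixed by the edge.\<close>
  have rel: "norm_map (snd M') \<circ> g = norm_map (snd M) \<circ> h \<longleftrightarrow>
      (\<forall>x. diameter (snd M') / diameter (snd M) * g x + position_index M M' = h x)"
    if "is_child M M'" for M M' :: gen_interval and h
  proof -
    have "diameter (snd M) > 0"
      using that net_interval_diameter_pos by (auto simp: is_child_def)
    then show ?thesis
      by (auto simp: fun_eq_iff norm_map_def position_index_def field_simps)
  qed
  show ?thesis
    unfolding extends_by_iff[OF ch f g] extends_by_iff[OF ch0 f[unfolded V] g[unfolded V]]
    unfolding comp_assoc rel[OF ch] rel[OF ch0] ratio q V ..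
qed

text \<open>Both extensions of a word generating \<open>f\<close> have the same map; cancelling the
  injective map of that word leaves \<open>S_word w = S_word w'\<close>, and distinct letters have
  distinct maps. This justifies the \<open>THE\<close> in the transition matrix.\<close>

lemma extends_by_unique:
  assumes ch: "is_child N N'" and w: "extends_by N N' f g w" and w': "extends_by N N' f g w'"
  shows "w = w'"
proof -
  have N: "is_net_interval N"
    using ch by (simp add: is_child_def)
  have fg: "f \<in> neighbour_set N" "g \<in> neighbour_set N'"
    using w by (auto simp: extends_by_def neighbour_set_def)
  obtain \<sigma> where \<sigma>: "generates N \<sigma> f"
    using fg by (auto simp: neighbour_set_def)
  have r0: "r_word \<sigma> \<noteq> 0"
    using \<sigma> r_word_nonzero by (auto simp: generates_def cut_words_def)
  have "S_word (\<sigma> @ w) = S_word (\<sigma> @ w')"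
    using w w' generates_child_iff[OF ch \<sigma> fg(2)] extends_by_iff[OF ch fg]
      generates_iff[of N'] ch by (metis is_child_def)
  then have "S_word \<sigma> (S_word w x) = S_word \<sigma> (S_word w' x)" for x
    by (simp add: S_word_append fun_eq_iff)
  then have "r_word \<sigma> * S_word w x = r_word \<sigma> * S_word w' x" for x
    using S_word_affine[of \<sigma>] by (metis add_right_cancel)
  then have S: "S_word w = S_word w'"
    using r0 by (auto simp: fun_eq_iff)
  have "continuation (neighbour_set N) f w" "continuation (neighbour_set N) f w'"
    using w w' extends_by_iff[OF ch fg] by auto
  \<comment> \<open>The lengths agree because the case distinction in \<open>continuation\<close>
    depends on \<open>f\<close> alone.\<close>
  then consider "w = []" "w' = []" | i j where "w = [i]" "w' = [j]" "i \<in> I" "j \<in> I"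
    by (auto simp: continuation_def split: if_splits)
  then show ?thesis
    using S distinct_maps by cases (auto simp: S_word_single dest: inj_onD)
qed

lemma extends_by_generates:
  assumes ch: "is_child N N'" and "extends_by N N' f g w" "generates N \<sigma> f"
  shows "generates N' (\<sigma> @ w) g"
proof -
  have "f \<in> neighbour_set N" "g \<in> neighbour_set N'"
    using assms(2) by (auto simp: extends_by_def neighbour_set_def)
  then show ?thesis
    using generates_child_iff[OF ch assms(3)] extends_by_iff[OF ch] assms(2) by blast
qed

lemma generates_child_decompose:
  assumes ch: "is_child N N'" and \<tau>: "generates N' \<tau> g"
  shows "\<exists>\<sigma> w f. \<tau> = \<sigma> @ w \<and> generates N \<sigma> f \<and> extends_by N N' f g w"
proof -
  have N: "is_net_interval N" and t: "fst N' = trans_gen N"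
    using ch by (auto simp: is_child_def)
  have "\<tau> \<in> cut_words (trans_gen N)" "S_word \<tau> ` K \<inter> interior (snd N) \<noteq> {}"
    using \<tau> child_interior_subset[OF ch] t by (auto simp: generates_def)
  then obtain \<sigma> w f where *: "\<tau> = \<sigma> @ w" "generates N \<sigma> f"
    "continuation (neighbour_set N) f w"
    using cut_word_decompose[OF N] by blast
  have "generates N' (\<sigma> @ w) g"
    using \<tau> *(1) by simp
  then have "extends_by N N' f g w"
    unfolding extends_by_def using continuation_lists[OF *(3)] *(2) by metis
  then show ?thesis
    using *(1,2) by metis
qed

lemma neighbour_set_subset_all: "is_net_interval N \<Longrightarrow> neighbour_set N \<subseteq> all_neighbours"
  by (auto simp: all_neighbours_def)

end

section \<open>Ordered neighbour lists and weights\<close>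

context self_similar_measure
begin

lemma ordered_props:
  assumes "finite V" "V \<subseteq> all_neighbours"
  shows "set (ordered V) = V" "distinct (ordered V)"
proof -
  let ?P = "\<lambda>f g. (f, g) \<in> ord \<and> f \<noteq> g"
  obtain fs where fs: "set fs = V" "sorted_wrt ?P fs"
    using linear_order_list_exists[OF linear_ord assms] by blast
  have asym: "asymp ?P"
    using linear_ord
    by (auto simp: asymp_on_def linear_order_on_def partial_order_on_def dest: antisymD)
  have "ordered V = fs"
    unfolding ordered_def
    using fs sorted_wrt_strict_unique[OF asym] by (intro the_equality) auto
  moreover have "distinct fs"
    using fs(2) by (induction fs) auto
  ultimately show "set (ordered V) = V" "distinct (ordered V)"
    using fs by auto
qed

lemma ordered_neighbour_set:
  assumes "is_net_interval N"
  shows "set (ordered (neighbour_set N)) = neighbour_set N"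
    and "distinct (ordered (neighbour_set N))"
    and "length (ordered (neighbour_set N)) = card (neighbour_set N)"
  using ordered_props[OF finite_neighbour_set[OF assms] neighbour_set_subset_all[OF assms]]
    distinct_card by metis+

lemma p_word_append: "p_word (\<sigma> @ \<tau>) = p_word \<sigma> * p_word \<tau>"
  by (simp add: p_word_def)

lemma measure_sim_vimage_le:
  assumes "E \<in> sets borel" "i \<in> I"
  shows "p i * measure M (sim r d i -` E) \<le> measure M E"
  unfolding self_similar[OF assms(1)]
  using assms(2) finite_I p_pos by (intro member_le_sum) (auto intro!: mult_nonneg_nonneg simp: less_imp_le)

lemma vimage_neighbour:
  assumes "is_net_interval N" "generates N \<sigma> f"
  shows "f -` {0<..<1} = S_word \<sigma> -` interior (snd N)"
proof -
  obtain a b where ab: "a < b" "snd N = {a..b}"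
    by (rule net_interval_cases[OF assms(1)]) blast
  have "f = (\<lambda>y. (y - a) / (b - a)) \<circ> S_word \<sigma>"
    using assms(2) norm_map_interval(2)[OF ab(1)] ab(2) by (simp add: generates_def)
  then show ?thesis
    using ab by (auto simp: field_simps)
qed

text \<open>
  Replaces the positivity of the weights: when \<open>weight f = 0\<close>, the quotient
  \<open>weight g / weight f\<close> in the transition matrix is the junk value 0, which is then harmless.
\<close>

lemma weight_extension_zero:
  assumes ch: "is_child N N'" and w: "extends_by N N' f g w" and 0: "weight f = 0"
  shows "weight g = 0"
proof -
  interpret prob_space M
    by (rule prob_M)
  have N: "is_net_interval N" and N': "is_net_interval N'"
    using ch by (auto simp: is_child_def)
  obtain \<sigma> where \<sigma>: "generates N \<sigma> f" "generates N' (\<sigma> @ w) g"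
    using w by (auto simp: extends_by_def)
  have cont: "continuous_on UNIV (S_word \<sigma>)"
  proof -
    have "continuous_on UNIV (\<lambda>x. r_word \<sigma> * x + S_word \<sigma> 0)"
      by (intro continuous_intros)
    then show ?thesis
      by (simp flip: S_word_affine)
  qed
  \<comment> \<open>\<open>A\<close> is contained in the preimage measured by
    \<open>weight f\<close>, so it is null; the set measured by \<open>weight g\<close> is
    \<open>A\<close> or its pullback under a single map.\<close>
  define A where "A = S_word \<sigma> -` interior (snd N')"
  have opn: "open (S_word \<sigma> -` interior (snd X))" for X :: gen_interval
    using cont by (intro open_vimage) auto
  have A: "A \<in> sets borel"
    using opn by (auto simp: A_def)
  have "measure M A \<le> weight f"
    unfolding weight_def vimage_neighbour[OF N \<sigma>(1)]
    using child_interior_subset[OF ch] opn sets_M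
    by (intro finite_measure_mono) (auto simp: A_def)
  then have A0: "measure M A = 0"
    using 0 measure_nonneg[of M A] by simp
  have wg: "weight g = measure M (S_word w -` A)"
    unfolding weight_def vimage_neighbour[OF N' \<sigma>(2)] A_def
    by (simp add: S_word_append vimage_comp)
  consider "w = []" | i where "i \<in> I" "w = [i]"
    using w by (auto simp: extends_by_def)
  then show ?thesis
  proof cases
    case 1
    then show ?thesis
      using A0 wg by (simp add: S_word_Nil)
  next
    case 2
    then have "p i * weight g \<le> 0"
      using measure_sim_vimage_le[OF A] A0 wg by (simp add: S_word_single)
    moreover have "weight g \<ge> 0"
      by (simp add: weight_def)
    ultimately show ?thesis
      using p_pos[OF 2(1)] by (metis antisym_conv mult_le_0_iff not_le)
  qed
qed

section \<open>One transition step\<close>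

text \<open>The pair picked by \<open>SOME\<close> may differ from the given one, but it induces the
  same edge, and \<open>extends_by_cong\<close> gives the same entries.\<close>

lemma transition_matrix_child:
  assumes ch: "is_child N N'"
  defines "fs \<equiv> ordered (neighbour_set N)" and "gs \<equiv> ordered (neighbour_set N')"
  shows "transition_matrix (transition_edge N N') =
    mat (length fs) (length gs) (\<lambda>(i, j).
      if \<exists>w. extends_by N N' (fs ! i) (gs ! j) w
      then weight (gs ! j) / weight (fs ! i) * p_word (THE w. extends_by N N' (fs ! i) (gs ! j) w)
      else 0)"
proof -
  let ?e = "transition_edge N N'"
  let ?Q = "\<lambda>(X, X'). is_child X X' \<and> ?e = transition_edge X X'"
  obtain X X' where X: "(SOME P. ?Q P) = (X, X')"
    by (rule prod.exhaust)
  have "?Q (SOME P. ?Q P)"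
    using ch by (intro someI[of ?Q "(N, N')"]) simp
  then have ch0: "is_child X X'" and e: "?e = transition_edge X X'"
    unfolding X by auto
  have st: "source ?e = neighbour_set N" "target ?e = neighbour_set N'"
    by (auto simp: transition_edge_def source_def target_def)
  have N: "is_net_interval N" "is_net_interval N'"
    using ch by (auto simp: is_child_def)
  have cong: "extends_by X X' (fs ! i) (gs ! j) = extends_by N N' (fs ! i) (gs ! j)"
    if "i < length fs" "j < length gs" for i j
    using extends_by_cong[OF ch ch0 e] that ordered_neighbour_set(1)[OF N(1)]
      ordered_neighbour_set(1)[OF N(2)]
    by (intro ext) (metis fs_def gs_def nth_mem)
  show ?thesis
    unfolding transition_matrix_def X Let_def st fs_def[symmetric] gs_def[symmetric]
    by (rule eq_matI) (auto simp: cong)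
qed

text \<open>Appending the unique continuation is a bijection from pairs of an extendable neighbour
  and a word generating it onto the words generating \<open>g\<close>, and \<open>p_word\<close> is
  multiplicative.\<close>

lemma sum_neighbour_words:
  assumes ch: "is_child N N'"
  shows "(\<Sum>f\<in>neighbour_set N. if \<exists>w. extends_by N N' f g w
           then (\<Sum>\<sigma> | generates N \<sigma> f. p_word \<sigma>) * p_word (THE w. extends_by N N' f g w) else 0)
       = (\<Sum>\<tau> | generates N' \<tau> g. p_word \<tau>)"
proof -
  have N: "is_net_interval N"
    using ch by (simp add: is_child_def)
  define F where "F = {f \<in> neighbour_set N. \<exists>w. extends_by N N' f g w}"
  define W where "W f = (THE w. extends_by N N' f g w)" for f
  have Weq: "W f = w" if "extends_by N N' f g w" for f w
    unfolding W_def using that extends_by_unique[OF ch] by (intro the_equality) auto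
  have bij: "bij_betw (\<lambda>(f, \<sigma>). \<sigma> @ W f) (SIGMA f:F. {\<sigma>. generates N \<sigma> f}) {\<tau>. generates N' \<tau> g}"
    unfolding bij_betw_def
  proof
    show "inj_on (\<lambda>(f, \<sigma>). \<sigma> @ W f) (SIGMA f:F. {\<sigma>. generates N \<sigma> f})"
    proof (rule inj_onI, clarsimp)
      fix f \<sigma> f' \<sigma>'
      assume gen: "generates N \<sigma> f" "generates N \<sigma>' f'" and eq: "\<sigma> @ W f = \<sigma>' @ W f'"
      \<comment> \<open>Both are cut prefixes of the same word; the word then determines the
        neighbour.\<close>
      have "\<sigma> = \<sigma>'"
        using cut_words_prefix_unique[OF _ _ eq, of "fst N"] gen by (simp add: generates_def)
      then show "f = f' \<and> \<sigma> = \<sigma>'"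
        using gen by (simp add: generates_def)
    qed
    show "(\<lambda>(f, \<sigma>). \<sigma> @ W f) ` (SIGMA f:F. {\<sigma>. generates N \<sigma> f}) = {\<tau>. generates N' \<tau> g}"
    proof (intro equalityI subsetI)
      fix \<tau> assume "\<tau> \<in> (\<lambda>(f, \<sigma>). \<sigma> @ W f) ` (SIGMA f:F. {\<sigma>. generates N \<sigma> f})"
      then obtain f \<sigma> w where "\<tau> = \<sigma> @ W f" "generates N \<sigma> f" "extends_by N N' f g w"
        by (auto simp: F_def)
      then show "\<tau> \<in> {\<tau>. generates N' \<tau> g}"
        using extends_by_generates[OF ch] Weq by auto
    next
      fix \<tau> assume "\<tau> \<in> {\<tau>. generates N' \<tau> g}"
      then obtain \<sigma> w f where *: "\<tau> = \<sigma> @ w" "generates N \<sigma> f" "extends_by N N' f g w"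
        using generates_child_decompose[OF ch] by blast
      then have "f \<in> F"
        by (auto simp: F_def neighbour_set_def)
      then show "\<tau> \<in> (\<lambda>(f, \<sigma>). \<sigma> @ W f) ` (SIGMA f:F. {\<sigma>. generates N \<sigma> f})"
        using * Weq by force
    qed
  qed
  have finF: "finite F"
    using finite_neighbour_set[OF N] by (simp add: F_def)
  have "(\<Sum>\<tau> | generates N' \<tau> g. p_word \<tau>)
      = (\<Sum>(f, \<sigma>)\<in>(SIGMA f:F. {\<sigma>. generates N \<sigma> f}). p_word (\<sigma> @ W f))"
    by (subst sum.reindex_bij_betw[OF bij, symmetric]) (simp add: case_prod_unfold)
  also have "\<dots> = (\<Sum>f\<in>F. \<Sum>\<sigma> | generates N \<sigma> f. p_word (\<sigma> @ W f))"
    using finF finite_generates[OF N] by (subst sum.Sigma) auto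
  also have "\<dots> = (\<Sum>f\<in>F. (\<Sum>\<sigma> | generates N \<sigma> f. p_word \<sigma>) * p_word (W f))"
    by (simp add: p_word_append sum_distrib_right)
  also have "\<dots> = (\<Sum>f\<in>neighbour_set N. if \<exists>w. extends_by N N' f g w
           then (\<Sum>\<sigma> | generates N \<sigma> f. p_word \<sigma>) * p_word (W f) else 0)"
    unfolding F_def using finite_neighbour_set[OF N] by (rule sum.inter_filter)
  finally show ?thesis
    unfolding W_def by (rule sym)
qed

lemma measure_vector_child:
  assumes ch: "is_child N N'"
  shows "measure_vector N * transition_matrix (transition_edge N N') = measure_vector N'"
proof -
  define fs where "fs = ordered (neighbour_set N)"
  define gs where "gs = ordered (neighbour_set N')"
  define P where "P f = (\<Sum>\<sigma> | generates N \<sigma> f. p_word \<sigma>)" for f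
  define T where "T f g = (if \<exists>w. extends_by N N' f g w
    then weight g / weight f * p_word (THE w. extends_by N N' f g w) else 0)" for f g
  have N: "is_net_interval N"
    using ch by (simp add: is_child_def)
  note fs = ordered_neighbour_set[OF N, folded fs_def]
  have entry: "(\<Sum>i<length fs. weight (fs ! i) * P (fs ! i) * T (fs ! i) g)
      = weight g * (\<Sum>\<tau> | generates N' \<tau> g. p_word \<tau>)" for g
  proof -
    have "(\<Sum>i<length fs. weight (fs ! i) * P (fs ! i) * T (fs ! i) g)
        = (\<Sum>f\<in>neighbour_set N. weight f * P f * T f g)"
      using sum.reindex_bij_betw[OF bij_betw_nth[OF fs(2) refl fs(1)[symmetric]],
          of "\<lambda>f. weight f * P f * T f g"] .
    also have "\<dots> = (\<Sum>f\<in>neighbour_set N. weight g * (if \<exists>w. extends_by N N' f g w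
        then P f * p_word (THE w. extends_by N N' f g w) else 0))"
    proof (rule sum.cong[OF refl])
      fix f
      show "weight f * P f * T f g = weight g * (if \<exists>w. extends_by N N' f g w
        then P f * p_word (THE w. extends_by N N' f g w) else 0)"
        \<comment> \<open>A nonzero \<open>weight f\<close> cancels; if it is zero, both sides
          vanish.\<close>
        using weight_extension_zero[OF ch, of f g] by (cases "weight f = 0") (auto simp: T_def)
    qed
    also have "\<dots> = weight g * (\<Sum>\<tau> | generates N' \<tau> g. p_word \<tau>)"
      unfolding sum_distrib_left[symmetric] P_def sum_neighbour_words[OF ch] ..
    finally show ?thesis .
  qed
  have "transition_matrix (transition_edge N N')
      = mat (length fs) (length gs) (\<lambda>(i, j). T (fs ! i) (gs ! j))"
    unfolding transition_matrix_child[OF ch] fs_def gs_def T_def ..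
  moreover have "measure_vector N = mat 1 (length fs) (\<lambda>(_, j). weight (fs ! j) * P (fs ! j))"
    by (simp add: measure_vector_def fs_def P_def Let_def)
  moreover have "measure_vector N' = mat 1 (length gs)
      (\<lambda>(_, j). weight (gs ! j) * (\<Sum>\<tau> | generates N' \<tau> (gs ! j). p_word \<tau>))"
    by (simp add: measure_vector_def gs_def Let_def)
  ultimately show ?thesis
    by (intro eq_matI) (auto simp: scalar_prod_def atLeast0LessThan entry)
qed

section \<open>Products along paths\<close>

text \<open>The dimensions are carried through the induction because associativity of matrix
  products requires them.\<close>

lemma measure_vector_path:
  assumes "realizes N \<eta>"
  shows "path_matrix (neighbour_set (N 0)) \<eta> \<in>
      carrier_mat (card (neighbour_set (N 0))) (card (neighbour_set (N (length \<eta>)))) \<and>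
    measure_vector (N 0) * path_matrix (neighbour_set (N 0)) \<eta> = measure_vector (N (length \<eta>))"
  using assms
proof (induction \<eta> arbitrary: N)
  case Nil
  then have "is_net_interval (N 0)"
    by (simp add: realizes_def)
  then have "measure_vector (N 0) \<in> carrier_mat 1 (card (neighbour_set (N 0)))"
    by (simp add: measure_vector_def Let_def ordered_neighbour_set)
  then show ?case by simp
next
  case (Cons e \<eta>)
  have ch: "is_child (N 0) (N 1)" and e: "e = transition_edge (N 0) (N 1)"
    using Cons.prems by (auto simp: realizes_def)
  have nets: "is_net_interval (N 0)" "is_net_interval (N 1)"
    using ch by (auto simp: is_child_def)
  \<comment> \<open>Dropping the first net interval realizes the rest of the path.\<close>
  have "realizes (\<lambda>i. N (Suc i)) \<eta>"
    using Cons.prems by (auto simp: realizes_def)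
  from Cons.IH[OF this]
  have IH: "path_matrix (neighbour_set (N 1)) \<eta> \<in>
      carrier_mat (card (neighbour_set (N 1))) (card (neighbour_set (N (length (e # \<eta>)))))"
    "measure_vector (N 1) * path_matrix (neighbour_set (N 1)) \<eta> = measure_vector (N (length (e # \<eta>)))"
    by auto
  have T: "transition_matrix e \<in> carrier_mat (card (neighbour_set (N 0))) (card (neighbour_set (N 1)))"
    unfolding e transition_matrix_child[OF ch] by (simp add: ordered_neighbour_set nets del: One_nat_def)
  have v: "measure_vector (N 0) \<in> carrier_mat 1 (card (neighbour_set (N 0)))"
    by (simp add: measure_vector_def Let_def ordered_neighbour_set nets)
  have tgt: "target e = neighbour_set (N 1)"
    by (simp add: e target_def transition_edge_def)
  let ?A = "path_matrix (neighbour_set (N 1)) \<eta>"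
  have "measure_vector (N 0) * (transition_matrix e * ?A) = measure_vector (N (length (e # \<eta>)))"
    using assoc_mult_mat[OF v T IH(1)] measure_vector_child[OF ch] IH(2) by (simp only: e)
  then show ?case
    using mult_carrier_mat[OF T IH(1)] tgt by simp
qed

end

theorem theorem2p12:
  fixes I :: "'i set" and r d p :: "'i \<Rightarrow> real" and K :: "real set" and M :: "real measure"
    and ord :: "(real \<Rightarrow> real) rel"
    and \<eta> :: "edge list" and N :: "nat \<Rightarrow> gen_interval"
  assumes "self_similar_measure I r d K p M ord"
    and "ifs.admissible_path I r d K \<eta>"
    and "ifs.realizes I r d K N \<eta>"
  shows "self_similar_measure.measure_vector I r d K p M ord (N 0)
           * self_similar_measure.path_matrix I r d K p M ord
               (ifs.neighbour_set I r d K (N 0)) \<eta>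
         = self_similar_measure.measure_vector I r d K p M ord (N (length \<eta>))"
  using self_similar_measure.measure_vector_path[OF assms(1,3)] by blast

end
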